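(* Let $A,B,C,D$ be non-zero $3\times 3$ complex matrices, and consider the assignment $$\rho(\sigma_1)=\begin{pmatrix}A&B\\ C&D\end{pmatrix},\qquad \rho(\sigma_2)=\begin{pmatrix}A&-B\\ -C&D\end{pmatrix}$$ of $6\times 6$ complex matrices to the generators $\sigma_1,\sigma_2$ of the braid group $B_3$. Then $\rho$ defines a representation $\rho:B_3\to GL(6,\mathbb{C})$ (that is, it extends to a group homomorphism) if and only if $\det(\rho(\sigma_i))\neq 0$ for $i=1,2$ and $$A^2B-BCB-ABD+BD^2=0,$$ $$CA^2-DCA-CBC+D^2C=0.$$
   Context: $B_3=\langle \sigma_1,\sigma_2 \mid \sigma_1\sigma_2\sigma_1=\sigma_2\sigma_1\sigma_2\rangle$ is the braid group on three strings. *)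

theory Defs
  imports "Jordan_Normal_Form.Determinant" "HOL-Algebra.Group"
begin

text \<open>
  A letter \<open>(x, True)\<close> stands for the generator \<open>x\<close> and \<open>(x, False)\<close> for its formal inverse.
  A set \<open>R\<close> of pairs of words is read as the set of defining relations \<open>u = v\<close>.
  The generators are all elements of the type \<open>'a\<close>.
\<close>

type_synonym 'a gword = "('a \<times> bool) list"

inductive pres_eq :: "('a gword \<times> 'a gword) set \<Rightarrow> 'a gword \<Rightarrow> 'a gword \<Rightarrow> bool"
  for R :: "('a gword \<times> 'a gword) set" where
  refl: "pres_eq R u u"
| sym: "pres_eq R u v \<Longrightarrow> pres_eq R v u"
| trans: "pres_eq R u v \<Longrightarrow> pres_eq R v w \<Longrightarrow> pres_eq R u w"
| cong: "pres_eq R u v \<Longrightarrow> pres_eq R u' v' \<Longrightarrow> pres_eq R (u @ u') (v @ v')"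
| cancel: "pres_eq R [(x, b), (x, \<not> b)] []"
| rel: "(u, v) \<in> R \<Longrightarrow> pres_eq R u v"

definition pres_class :: "('a gword \<times> 'a gword) set \<Rightarrow> 'a gword \<Rightarrow> 'a gword set" where
  "pres_class R u = {v. pres_eq R u v}"

definition presented_group :: "('a gword \<times> 'a gword) set \<Rightarrow> 'a gword set monoid" where
  "presented_group R =
    \<lparr>carrier = range (pres_class R),
     mult = (\<lambda>X Y. \<Union>u\<in>X. \<Union>v\<in>Y. pres_class R (u @ v)),
     one = pres_class R []\<rparr>"

lemma pres_class_eq_iff: "pres_class R u = pres_class R v \<longleftrightarrow> pres_eq R u v"
proof
  assume "pres_class R u = pres_class R v"
  then have "v \<in> pres_class R u"
    by (simp add: pres_class_def pres_eq.refl)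
  then show "pres_eq R u v"
    by (simp add: pres_class_def)
next
  assume uv: "pres_eq R u v"
  have "pres_eq R u w \<longleftrightarrow> pres_eq R v w" for w
    using pres_eq.trans[OF uv] pres_eq.trans[OF pres_eq.sym[OF uv]] by blast
  then show "pres_class R u = pres_class R v"
    by (simp add: pres_class_def)
qed

lemma presented_group_mult:
  "pres_class R u \<otimes>\<^bsub>presented_group R\<^esub> pres_class R v = pres_class R (u @ v)"
proof -
  have "pres_class R (u' @ v') = pres_class R (u @ v)"
    if "u' \<in> pres_class R u" "v' \<in> pres_class R v" for u' v'
  proof -
    have "pres_eq R u u'" "pres_eq R v v'"
      using that by (simp_all add: pres_class_def)
    then show ?thesis
      unfolding pres_class_eq_iff by (rule pres_eq.sym[OF pres_eq.cong])
  qed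
  moreover have "u \<in> pres_class R u" "v \<in> pres_class R v"
    by (simp_all add: pres_class_def pres_eq.refl)
  ultimately have "(\<Union>u'\<in>pres_class R u. \<Union>v'\<in>pres_class R v. pres_class R (u' @ v')) = pres_class R (u @ v)"
    by blast
  then show ?thesis
    by (simp add: presented_group_def)
qed

lemma pres_eq_inverse:
  "pres_eq R (rev (map (map_prod id Not) u) @ u) []"
proof (induction u)
  case Nil
  show ?case by (simp add: pres_eq.refl)
next
  case (Cons a u)
  obtain x b where a: "a = (x, b)" by fastforce
  let ?i = "rev (map (map_prod id Not) u)"
  have "pres_eq R [(x, \<not> b), (x, b)] []"
    using pres_eq.cancel[of R x "\<not> b"] by simp
  then have "pres_eq R (?i @ ([(x, \<not> b), (x, b)] @ u)) (?i @ ([] @ u))"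
    by (intro pres_eq.cong pres_eq.refl)
  then have "pres_eq R (rev (map (map_prod id Not) (a # u)) @ a # u) (?i @ u)"
    by (simp add: a)
  then show ?case
    using Cons.IH by (rule pres_eq.trans)
qed

lemma group_presented_group: "group (presented_group R)"
proof (rule groupI)
  let ?G = "presented_group R"
  have carr: "carrier ?G = range (pres_class R)" and one: "\<one>\<^bsub>?G\<^esub> = pres_class R []"
    by (simp_all add: presented_group_def)
  show "x \<otimes>\<^bsub>?G\<^esub> y \<in> carrier ?G" if "x \<in> carrier ?G" "y \<in> carrier ?G" for x y
    using that by (auto simp: carr presented_group_mult)
  show "\<one>\<^bsub>?G\<^esub> \<in> carrier ?G"
    by (simp add: carr one)
  show "x \<otimes>\<^bsub>?G\<^esub> y \<otimes>\<^bsub>?G\<^esub> z = x \<otimes>\<^bsub>?G\<^esub> (y \<otimes>\<^bsub>?G\<^esub> z)"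
    if "x \<in> carrier ?G" "y \<in> carrier ?G" "z \<in> carrier ?G" for x y z
    using that by (auto simp: carr presented_group_mult)
  show "\<one>\<^bsub>?G\<^esub> \<otimes>\<^bsub>?G\<^esub> x = x" if "x \<in> carrier ?G" for x
    using that by (auto simp: carr one presented_group_mult)
  show "\<exists>y\<in>carrier ?G. y \<otimes>\<^bsub>?G\<^esub> x = \<one>\<^bsub>?G\<^esub>" if x: "x \<in> carrier ?G" for x
  proof -
    obtain u where u: "x = pres_class R u" using x carr by auto
    have "pres_class R (rev (map (map_prod id Not) u)) \<otimes>\<^bsub>?G\<^esub> x = \<one>\<^bsub>?G\<^esub>"
      unfolding u one presented_group_mult pres_class_eq_iff by (rule pres_eq_inverse)
    then show ?thesis by (auto simp: carr)
  qed
qed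

datatype braid_gen = S1 | S2

definition B3_relations :: "(braid_gen gword \<times> braid_gen gword) set" where
  "B3_relations =
    {([(S1, True), (S2, True), (S1, True)], [(S2, True), (S1, True), (S2, True)])}"

definition B3 :: "braid_gen gword set monoid" where
  "B3 = presented_group B3_relations"

definition sigma1 :: "braid_gen gword set" where
  "sigma1 = pres_class B3_relations [(S1, True)]"

definition sigma2 :: "braid_gen gword set" where
  "sigma2 = pres_class B3_relations [(S2, True)]"

definition GL :: "nat \<Rightarrow> complex mat monoid" where
  "GL n = units_of (ring_mat TYPE(complex) n ())"

end

theory Submission
  imports Defs
begin

text \<open>
  Homomorphisms out of a presented group correspond to assignments of the generators that satisfy
  the relations, so \<open>\<rho>\<close> exists iff both matrices \<open>X\<close>, \<open>Y\<close> are invertible and \<open>X Y X = Y X Y\<close>.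
  Now \<open>Y = E X E\<close> with \<open>E = diag(I, -I)\<close>, and therefore \<open>Y X Y = E (X Y X) E\<close> arises from \<open>X Y X\<close>
  by negating the off-diagonal blocks. The braid relation thus says that the off-diagonal blocks
  of \<open>X Y X\<close> vanish, and these are the two given expressions.
\<close>

section \<open>Homomorphisms out of presented groups and out of \<open>B3\<close>\<close>

fun word_eval :: "('g, 'b) monoid_scheme \<Rightarrow> ('a \<Rightarrow> 'g) \<Rightarrow> 'a gword \<Rightarrow> 'g" where
  "word_eval G f [] = \<one>\<^bsub>G\<^esub>"
| "word_eval G f ((x, b) # u) = (if b then f x else inv\<^bsub>G\<^esub> f x) \<otimes>\<^bsub>G\<^esub> word_eval G f u"

context group
begin

lemma word_eval_closed:
  assumes "range f \<subseteq> carrier G"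
  shows "word_eval G f u \<in> carrier G"
proof (induction u)
  case (Cons a u)
  obtain x b where a: "a = (x, b)" by fastforce
  have "f x \<in> carrier G" using assms by auto
  then show ?case using Cons.IH by (simp add: a)
qed simp

lemma word_eval_append:
  assumes "range f \<subseteq> carrier G"
  shows "word_eval G f (u @ v) = word_eval G f u \<otimes> word_eval G f v"
proof (induction u)
  case Nil
  show ?case using word_eval_closed[OF assms] by simp
next
  case (Cons a u)
  obtain x b where a: "a = (x, b)" by fastforce
  have "f x \<in> carrier G" using assms by auto
  then show ?case
    using Cons.IH word_eval_closed[OF assms] by (simp add: a m_assoc)
qed

text \<open>This makes evaluation well defined on classes. Equality in the target group is a
  congruence for concatenation because evaluation is multiplicative, \<open>cancel\<close> holds by
  the group inverse, and \<open>rel\<close> is the hypothesis on \<open>R\<close>.\<close>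

lemma word_eval_pres_eq:
  assumes f: "range f \<subseteq> carrier G"
    and R: "\<And>u v. (u, v) \<in> R \<Longrightarrow> word_eval G f u = word_eval G f v"
    and uv: "pres_eq R u v"
  shows "word_eval G f u = word_eval G f v"
  using uv
proof (induction rule: pres_eq.induct)
  case (cancel x b)
  have "f x \<in> carrier G" using f by auto
  then show ?case by simp
qed (simp_all add: word_eval_append[OF f] R)

text \<open>Von Dyck's theorem: evaluation of words descends to the classes.\<close>

theorem presented_group_universal:
  assumes f: "range f \<subseteq> carrier G"
    and R: "\<And>u v. (u, v) \<in> R \<Longrightarrow> word_eval G f u = word_eval G f v"
  obtains h where "h \<in> hom (presented_group R) G" and "\<And>x. h (pres_class R [(x, True)]) = f x"
proof
  \<comment> \<open>A class is evaluated at an arbitrarily chosen representative;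
    \<open>word_eval_pres_eq\<close> shows that the choice does not matter.\<close>
  define h where "h X = word_eval G f (SOME u. u \<in> X)" for X
  have h: "h (pres_class R u) = word_eval G f u" for u
  proof -
    have "u \<in> pres_class R u"
      by (simp add: pres_class_def pres_eq.refl)
    then have "(SOME v. v \<in> pres_class R u) \<in> pres_class R u"
      by (rule someI)
    then have "pres_eq R u (SOME v. v \<in> pres_class R u)"
      by (simp add: pres_class_def)
    from word_eval_pres_eq[OF f R this] show ?thesis
      by (simp add: h_def)
  qed
  have "carrier (presented_group R) = range (pres_class R)"
    by (simp add: presented_group_def)
  then show "h \<in> hom (presented_group R) G"
    by (auto simp: hom_def h presented_group_mult word_eval_append[OF f] word_eval_closed[OF f])
  show "h (pres_class R [(x, True)]) = f x" for x
  proof -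
    have "f x \<in> carrier G" using f by auto
    then show ?thesis by (simp add: h)
  qed
qed

text \<open>A homomorphism carries the braid relation between the classes over to \<open>G\<close>;
  conversely, von Dyck's theorem needs only this single relation to be checked.\<close>

lemma hom_B3_iff:
  "(\<exists>\<rho> \<in> hom B3 G. \<rho> sigma1 = x \<and> \<rho> sigma2 = y) \<longleftrightarrow>
    x \<in> carrier G \<and> y \<in> carrier G \<and> x \<otimes> y \<otimes> x = y \<otimes> x \<otimes> y"
proof
  assume "\<exists>\<rho> \<in> hom B3 G. \<rho> sigma1 = x \<and> \<rho> sigma2 = y"
  then obtain \<rho> where \<rho>: "\<rho> \<in> hom B3 G" and xy: "\<rho> sigma1 = x" "\<rho> sigma2 = y"
    by blast
  have c: "sigma1 \<in> carrier B3" "sigma2 \<in> carrier B3"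
    by (simp_all add: B3_def presented_group_def sigma1_def sigma2_def)
  have B3: "group B3"
    unfolding B3_def by (rule group_presented_group)
  have "pres_eq B3_relations [(S1, True), (S2, True), (S1, True)] [(S2, True), (S1, True), (S2, True)]"
    by (rule pres_eq.rel) (simp add: B3_relations_def)
  then have "sigma1 \<otimes>\<^bsub>B3\<^esub> sigma2 \<otimes>\<^bsub>B3\<^esub> sigma1 = sigma2 \<otimes>\<^bsub>B3\<^esub> sigma1 \<otimes>\<^bsub>B3\<^esub> sigma2"
    by (simp add: B3_def sigma1_def sigma2_def presented_group_mult pres_class_eq_iff)
  then have "\<rho> (sigma1 \<otimes>\<^bsub>B3\<^esub> sigma2 \<otimes>\<^bsub>B3\<^esub> sigma1) = \<rho> (sigma2 \<otimes>\<^bsub>B3\<^esub> sigma1 \<otimes>\<^bsub>B3\<^esub> sigma2)"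
    by simp
  then have "x \<otimes> y \<otimes> x = y \<otimes> x \<otimes> y"
    using c B3 by (simp add: hom_mult[OF \<rho>] xy group.is_monoid monoid.m_closed)
  then show "x \<in> carrier G \<and> y \<in> carrier G \<and> x \<otimes> y \<otimes> x = y \<otimes> x \<otimes> y"
    using hom_in_carrier[OF \<rho>] c xy by blast
next
  assume xy: "x \<in> carrier G \<and> y \<in> carrier G \<and> x \<otimes> y \<otimes> x = y \<otimes> x \<otimes> y"
  define f where "f = case_braid_gen x y"
  have f: "range f \<subseteq> carrier G"
    using xy by (auto simp: f_def split: braid_gen.split)
  \<comment> \<open>Words evaluate with brackets to the right, whereas the hypothesis is bracketed
    to the left, hence \<open>m_assoc\<close>.\<close>
  have "word_eval G f u = word_eval G f v" if "(u, v) \<in> B3_relations" for u v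
    using that xy by (auto simp: B3_relations_def f_def m_assoc)
  then obtain h where "h \<in> hom B3 G" "\<And>s. h (pres_class B3_relations [(s, True)]) = f s"
    using presented_group_universal[OF f] unfolding B3_def by blast
  then show "\<exists>\<rho> \<in> hom B3 G. \<rho> sigma1 = x \<and> \<rho> sigma2 = y"
    by (intro bexI[of _ h]) (simp_all add: sigma1_def sigma2_def f_def)
qed

end

section \<open>The general linear group\<close>

lemma group_GL: "group (GL n)"
  unfolding GL_def
  by (intro monoid.units_group ring.is_monoid ring_mat)

text \<open>\<open>GL n\<close> consists of the units of the matrix ring, and over a field these are
  detected by the determinant.\<close>

lemma carrier_GL_iff:
  assumes "X \<in> carrier_mat n n"
  shows "X \<in> carrier (GL n) \<longleftrightarrow> det X \<noteq> 0"
  using det_non_zero_imp_unit[OF assms, of "()"] unit_imp_det_non_zero[of X n "()"]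
  by (auto simp: GL_def units_of_carrier)

lemma mult_GL: "X \<otimes>\<^bsub>GL n\<^esub> Y = X * Y"
  by (simp add: GL_def units_of_mult ring_mat_def)

section \<open>Block matrices and the braid relation\<close>

lemma four_block_mat_eq_iff:
  assumes A: "A \<in> carrier_mat n n'" "A' \<in> carrier_mat n n'"
    and B: "B \<in> carrier_mat n m'" "B' \<in> carrier_mat n m'"
    and C: "C \<in> carrier_mat m n'" "C' \<in> carrier_mat m n'"
    and D: "D \<in> carrier_mat m m'" "D' \<in> carrier_mat m m'"
  shows "four_block_mat A B C D = four_block_mat A' B' C' D' \<longleftrightarrow>
    A = A' \<and> B = B' \<and> C = C' \<and> D = D'" (is "?X = ?Y \<longleftrightarrow> _")
proof
  assume eq: "?X = ?Y"
  have idx: "?X $$ (i, j) = ?Y $$ (i, j)" for i j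
    using eq by simp
  have "A = A'"
  proof (rule eq_matI)
    show "A $$ (i, j) = A' $$ (i, j)" if "i < dim_row A'" "j < dim_col A'" for i j
      using idx[of i j] that A B C D by simp
  qed (use A in auto)
  \<comment> \<open>The right-hand blocks start at column \<open>n'\<close> and the lower ones at
    row \<open>n\<close>, so the remaining comparisons shift the indices accordingly.\<close>
  moreover have "B = B'"
  proof (rule eq_matI)
    show "B $$ (i, j) = B' $$ (i, j)" if "i < dim_row B'" "j < dim_col B'" for i j
      using idx[of i "n' + j"] that A B C D by simp
  qed (use B in auto)
  moreover have "C = C'"
  proof (rule eq_matI)
    show "C $$ (i, j) = C' $$ (i, j)" if "i < dim_row C'" "j < dim_col C'" for i j
      using idx[of "n + i" j] that A B C D by simp
  qed (use C in auto)
  moreover have "D = D'"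
  proof (rule eq_matI)
    show "D $$ (i, j) = D' $$ (i, j)" if "i < dim_row D'" "j < dim_col D'" for i j
      using idx[of "n + i" "n' + j"] that A B C D by simp
  qed (use D in auto)
  ultimately show "A = A' \<and> B = B' \<and> C = C' \<and> D = D'"
    by blast
qed simp

text \<open>Entrywise \<open>z = - z\<close> gives \<open>2 * z = 0\<close>, which forces
  \<open>z = 0\<close> in characteristic zero.\<close>

lemma uminus_eq_self_mat_iff:
  fixes Z :: "'a::field_char_0 mat"
  assumes Z: "Z \<in> carrier_mat n m"
  shows "Z = - Z \<longleftrightarrow> Z = 0\<^sub>m n m"
proof
  assume eq: "Z = - Z"
  show "Z = 0\<^sub>m n m"
  proof (rule eq_matI)
    fix i j assume ij: "i < dim_row (0\<^sub>m n m :: 'a mat)" "j < dim_col (0\<^sub>m n m :: 'a mat)"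
    have "Z $$ (i, j) = (- Z) $$ (i, j)" using eq by simp
    then show "Z $$ (i, j) = 0\<^sub>m n m $$ (i, j)" using ij Z by simp
  qed (use Z in auto)
qed (auto intro: eq_matI)

text \<open>The effect of conjugation by \<open>E\<close> is verified by direct block
  multiplication, without introducing \<open>E\<close>. The diagonal blocks may have different sizes
  \<open>n\<close> and \<open>m\<close>.\<close>

lemma braid_relation_four_block_iff:
  fixes A B C D :: "'a::field_char_0 mat"
  assumes A: "A \<in> carrier_mat n n" and B: "B \<in> carrier_mat n m"
    and C: "C \<in> carrier_mat m n" and D: "D \<in> carrier_mat m m"
  defines "X \<equiv> four_block_mat A B C D" and "Y \<equiv> four_block_mat A (- B) (- C) D"
  shows "X * Y * X = Y * X * Y \<longleftrightarrow>
    A ^\<^sub>m 2 * B - B * C * B - A * B * D + B * D ^\<^sub>m 2 = 0\<^sub>m n m \<and>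
    C * A ^\<^sub>m 2 - D * C * A - C * B * C + D ^\<^sub>m 2 * C = 0\<^sub>m m n"
proof -
  note mult_block = mult_four_block_mat[where ?nr1.0=n and ?n1.0=n and ?n2.0=m and ?nr2.0=m
      and ?nc1.0=n and ?nc2.0=m]
  \<comment> \<open>These are the blocks of \<open>X * Y\<close>; exchanging the factors only
    changes the signs of \<open>Q\<close> and \<open>R\<close>.\<close>
  define P Q R S where "P = A * A - B * C" and "Q = B * D - A * B"
    and "R = C * A - D * C" and "S = D * D - C * B"
  have PQRS [simp]: "P \<in> carrier_mat n n" "Q \<in> carrier_mat n m" "R \<in> carrier_mat m n" "S \<in> carrier_mat m m"
    using A B C D by (auto simp: P_def Q_def R_def S_def)
  note [simp] = PQRS[THEN carrier_matD(1)] PQRS[THEN carrier_matD(2)]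
  note [simp] = A B C D carrier_matD[OF A] carrier_matD[OF B] carrier_matD[OF C] carrier_matD[OF D]
  have XY: "X * Y = four_block_mat P Q R S"
  proof -
    \<comment> \<open>With entries of products left unexpanded, each block identity becomes a linear
      identity between such entries.\<close>
    have "A * A + B * (- C) = P" "A * (- B) + B * D = Q" "C * A + D * (- C) = R" "C * (- B) + D * D = S"
      by (auto simp: P_def Q_def R_def S_def simp del: index_mult_mat(1) intro!: eq_matI)
    then show ?thesis
      unfolding X_def Y_def
      by (simp add: mult_block)
  qed
  have YX: "Y * X = four_block_mat P (- Q) (- R) S"
  proof -
    have "A * A + (- B) * C = P" "A * B + (- B) * D = - Q" "(- C) * A + D * C = - R" "(- C) * B + D * D = S"
      by (auto simp: P_def Q_def R_def S_def simp del: index_mult_mat(1) intro!: eq_matI)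
    then show ?thesis
      unfolding X_def Y_def
      by (simp add: mult_block)
  qed
  \<comment> \<open>The off-diagonal blocks of \<open>X * Y * X\<close>, which turn out to be the
    two expressions in the claim.\<close>
  define U V where "U = P * B + Q * D" and "V = R * A + S * C"
  have UV [simp]: "U \<in> carrier_mat n m" "V \<in> carrier_mat m n"
    by (auto simp: U_def V_def)
  have XYX: "X * Y * X = four_block_mat (P * A + Q * C) U V (R * B + S * D)"
    unfolding XY unfolding X_def U_def V_def
    by (simp add: mult_block)
  \<comment> \<open>In the diagonal blocks the sign changes cancel in pairs; in each off-diagonal
    block one sign survives in every term.\<close>
  have YXY: "Y * X * Y = four_block_mat (P * A + Q * C) (- U) (- V) (R * B + S * D)"
  proof -
    have "P * A + (- Q) * (- C) = P * A + Q * C" "P * (- B) + (- Q) * D = - U"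
      "(- R) * A + S * (- C) = - V" "(- R) * (- B) + S * D = R * B + S * D"
      by (auto simp: U_def V_def simp del: index_mult_mat(1) intro!: eq_matI)
    then show ?thesis
      unfolding YX unfolding Y_def
      by (simp add: mult_block)
  qed
  have "U = A * A * B - B * C * B + (B * D * D - A * B * D)"
    by (simp add: U_def P_def Q_def
        minus_mult_distrib_mat[OF mult_carrier_mat[OF A A] mult_carrier_mat[OF B C] B]
        minus_mult_distrib_mat[OF mult_carrier_mat[OF B D] mult_carrier_mat[OF A B] D])
  also have "\<dots> = A ^\<^sub>m 2 * B - B * C * B - A * B * D + B * D ^\<^sub>m 2"
    by (auto simp: numeral_2_eq_2 assoc_mult_mat[OF B D D] assoc_mult_mat[OF C A A]
        simp del: index_mult_mat(1) intro!: eq_matI)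
  finally have U: "U = A ^\<^sub>m 2 * B - B * C * B - A * B * D + B * D ^\<^sub>m 2" .
  have "V = C * A * A - D * C * A + (D * D * C - C * B * C)"
    by (simp add: V_def R_def S_def
        minus_mult_distrib_mat[OF mult_carrier_mat[OF C A] mult_carrier_mat[OF D C] A]
        minus_mult_distrib_mat[OF mult_carrier_mat[OF D D] mult_carrier_mat[OF C B] C])
  also have "\<dots> = C * A ^\<^sub>m 2 - D * C * A - C * B * C + D ^\<^sub>m 2 * C"
    by (auto simp: numeral_2_eq_2 assoc_mult_mat[OF B D D] assoc_mult_mat[OF C A A]
        simp del: index_mult_mat(1) intro!: eq_matI)
  finally have V: "V = C * A ^\<^sub>m 2 - D * C * A - C * B * C + D ^\<^sub>m 2 * C" .
  \<comment> \<open>The diagonal blocks already agree, so only the off-diagonal ones impose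
    conditions.\<close>
  have "X * Y * X = Y * X * Y \<longleftrightarrow> U = - U \<and> V = - V"
    unfolding XYX YXY by (subst four_block_mat_eq_iff[where n=n and n'=n and m=m and m'=m]) auto
  also have "\<dots> \<longleftrightarrow> U = 0\<^sub>m n m \<and> V = 0\<^sub>m m n"
    by (simp add: uminus_eq_self_mat_iff[OF UV(1)] uminus_eq_self_mat_iff[OF UV(2)])
  finally show ?thesis
    unfolding U V .
qed

theorem proposition4p1:
  fixes A B C D :: "complex mat"
  assumes "A \<in> carrier_mat 3 3" and "B \<in> carrier_mat 3 3"
    and "C \<in> carrier_mat 3 3" and "D \<in> carrier_mat 3 3"
    and "A \<noteq> 0\<^sub>m 3 3" and "B \<noteq> 0\<^sub>m 3 3" and "C \<noteq> 0\<^sub>m 3 3" and "D \<noteq> 0\<^sub>m 3 3"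
  shows "(\<exists>\<rho> \<in> hom B3 (GL 6).
            \<rho> sigma1 = four_block_mat A B C D \<and> \<rho> sigma2 = four_block_mat A (- B) (- C) D)
     \<longleftrightarrow> det (four_block_mat A B C D) \<noteq> 0 \<and> det (four_block_mat A (- B) (- C) D) \<noteq> 0 \<and>
         A ^\<^sub>m 2 * B - B * C * B - A * B * D + B * D ^\<^sub>m 2 = 0\<^sub>m 3 3 \<and>
         C * A ^\<^sub>m 2 - D * C * A - C * B * C + D ^\<^sub>m 2 * C = 0\<^sub>m 3 3"
proof -
  have "four_block_mat A B C D \<in> carrier_mat 6 6" "four_block_mat A (- B) (- C) D \<in> carrier_mat 6 6"
    using four_block_carrier_mat[OF assms(1,4)] by simp_all
  \<comment> \<open>The homomorphism becomes membership in \<open>GL 6\<close> plus the braid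
    relation; the former turns into the determinant conditions, the latter into the block equations
    with \<open>n = m = 3\<close>.\<close>
  then show ?thesis
    by (simp only: group.hom_B3_iff[OF group_GL] carrier_GL_iff mult_GL
        braid_relation_four_block_iff[OF assms(1-4)])
qed

end
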